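(* Let $\mathcal L$ be a finite relational language and $\mathcal H$ a hereditary $\mathcal L$-property. For every $\ell\geq 1$, $\mathrm{VC}_\ell(\mathcal H)=\infty$ if and only if $\mathrm{VC}^*_\ell(\mathcal H)=\infty$.
   Context: A hereditary $\mathcal{L}$-property is a class $\mathcal{H}$ of finite $\mathcal{L}$-structures closed under isomorphism and under (induced) substructures. All formulas are quantifier-free $\mathcal L$-formulas; a partitioned formula $\varphi(\bar x;\bar y)$ has its free variables split into tuples $\bar x,\bar y$. Boxes: Let $X$ be a set and $1\leq \ell\leq t$. An $(\ell,t)$-box in $X$ is a set $\prod_{i=1}^{\ell}A_i=\{\bar a_1\cdots\bar a_\ell:\bar a_i\in A_i\}\subseteq X^{t}$ (concatenation of tuples), where each $A_i\subseteq X^{k_i}$ is nonempty, $k_i\geq 1$, $k_1+\dots+k_\ell=t$; it has height $m$ if $|A_1|=\dots=|A_\ell|=m$. The underlying set of a set of tuples is the set of all coordinates of its elements. $\mathrm{VC}_\ell$: For an $\mathcal L$-structure $\mathcal M$ and $\bar b\in M^{|\bar x|}$ let $\varphi(\bar b;\mathcal M)=\{\bar a\in M^{|\bar y|}:\mathcal M\models\varphi(\bar b;\bar a)\}$ and $\mathcal F_\varphi(\mathcal M)=\{\varphi(\bar b;\mathcal M):\bar b\in M^{|\bar x|}\}$. A family $\mathcal F$ shatters $A$ if $\{F\cap A:F\in\mathcal F\}=\mathcal P(A)$. For $1\leq\ell\leq|\bar y|$, $\mathrm{VC}_\ell(\varphi,\mathcal M)$ is the supremum of all $m$ such that $\mathcal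 F_\varphi(\mathcal M)$ shatters an $(\ell,|\bar y|)$-box of height $m$ in $M$; $\mathrm{VC}_\ell(\varphi,\mathcal H)=\sup\{\mathrm{VC}_\ell(\varphi,\mathcal M):\mathcal M\in\mathcal H\}$, and $\mathrm{VC}_\ell(\mathcal H)$ is the supremum of $\mathrm{VC}_\ell(\varphi,\mathcal H)$ over all quantifier-free partitioned $\varphi$ for which it is defined. $\mathrm{VC}^*_\ell$: For $\mathbb{A}\subseteq X^{|\bar y|}$, a $\varphi$-type over $\mathbb A$ in the variables $\bar x$ is a maximal consistent subset of $\{\varphi(\bar x;\bar a),\neg\varphi(\bar x;\bar a):\bar a\in\mathbb A\}$; it is realized in $\mathcal M$ if $\mathbb A\subseteq M^{|\bar y|}$ and some $\bar b\in M^{|\bar x|}$ satisfies it. $S_\varphi(\mathbb A)$ is the set of $\varphi$-types over $\mathbb A$ realized in some member of $\mathcal H$. $S^{\emptyset}_n(\mathbb A)$ is the set of complete types in $n$ variables in the pure language of equality with parameters from the underlying set of $\mathbb A$. For $m\geq 1$ and $\rho\in S^\emptyset_{2|\bar x|}(\mathbb A)$, $S_{\varphi,m}(\mathbb A,\rho)$ is the set of all unions $p_1(\bar x_1)\cup\dots\cup p_m(\bar x_m)$ ($\bar x_i$ disjoint copies of $\bar x$), each $p_i\in S_\varphi(\mathbb A)$, such that there exist $\mathcal M\in\mathcal H$ and pairwise distinct $\bar a_1,\dots,\bar a_m\in M^{|\bar x|}$ with $\bar a_i$ realizing $p_i$ for each $i$ and $\rho(\bar a_i,\bar a_j)$ holding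 in $\mathcal M$ for all $i\neq j$. For $1\leq\ell\leq|\bar y|$, $\mathrm{VC}^*_\ell(\varphi,\mathcal H)$ is the supremum of all $m$ such that for some $(\ell,|\bar y|)$-box $\mathbb A$ of height $m$ (in some set) and some $\rho\in S^\emptyset_{2|\bar x|}(\mathbb A)$, $|S_{\varphi,m}(\mathbb A,\rho)|=2^{m^{\ell+1}}$; $\mathrm{VC}^*_\ell(\mathcal H)$ is the supremum of $\mathrm{VC}^*_\ell(\varphi,\mathcal H)$ over all quantifier-free partitioned $\varphi$ for which it is defined.
   Formalization: VC_ℓ(H)=∞ (likewise VC*_ℓ(H)=∞) is read as: some single quantifier-free φ has VC_ℓ(φ,H)=∞ (resp. VC*_ℓ(φ,H)=∞); with the supremum over all φ the claim fails, e.g. for ℓ=1 and H all finite sets with no relations. *)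

theory Defs
  imports Main "HOL-Library.Extended_Nat"
begin

record 'r language =
  symbols :: "'r set"
  arity :: "'r \<Rightarrow> nat"

record ('a, 'r) struct =
  univ :: "'a set"
  rel :: "'r \<Rightarrow> 'a list set"

definition tuples :: "'a set \<Rightarrow> nat \<Rightarrow> 'a list set" where
  "tuples X n = {xs. length xs = n \<and> set xs \<subseteq> X}"

definition is_struct :: "'r language \<Rightarrow> ('a, 'r) struct \<Rightarrow> bool" where
  "is_struct L M \<longleftrightarrow> univ M \<noteq> {} \<and>
     (\<forall>R\<in>symbols L. rel M R \<subseteq> tuples (univ M) (arity L R)) \<and>
     (\<forall>R. R \<notin> symbols L \<longrightarrow> rel M R = {})"

definition isomorphic :: "'r language \<Rightarrow> ('a, 'r) struct \<Rightarrow> ('a, 'r) struct \<Rightarrow> bool" where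
  "isomorphic L M N \<longleftrightarrow> (\<exists>f. bij_betw f (univ M) (univ N) \<and>
     (\<forall>R\<in>symbols L. \<forall>xs\<in>tuples (univ M) (arity L R). xs \<in> rel M R \<longleftrightarrow> map f xs \<in> rel N R))"

definition induced :: "('a, 'r) struct \<Rightarrow> 'a set \<Rightarrow> ('a, 'r) struct" where
  "induced M U = \<lparr>univ = U, rel = (\<lambda>R. {xs \<in> rel M R. set xs \<subseteq> U})\<rparr>"

text \<open>
  An isomorphism-closed class of finite structures is represented by those of its members whose
  universe is a subset of a type \<open>'a\<close>; this loses nothing as soon as \<open>'a\<close> is infinite, which the
  main statement assumes.
\<close>

definition hereditary_property :: "'r language \<Rightarrow> ('a, 'r) struct set \<Rightarrow> bool" where
  "hereditary_property L H \<longleftrightarrow>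
     (\<forall>M\<in>H. is_struct L M \<and> finite (univ M)) \<and>
     (\<forall>M\<in>H. \<forall>N. is_struct L N \<and> isomorphic L M N \<longrightarrow> N \<in> H) \<and>
     (\<forall>M\<in>H. \<forall>U. U \<subseteq> univ M \<and> U \<noteq> {} \<longrightarrow> induced M U \<in> H)"

datatype (rels: 'r, vars: 'v) qf =
    Eq 'v 'v
  | Rel 'r "'v list"
  | Neg "('r, 'v) qf"
  | Conj "('r, 'v) qf" "('r, 'v) qf"

primrec wf_qf :: "'r language \<Rightarrow> ('r, 'v) qf \<Rightarrow> bool" where
  "wf_qf L (Eq u v) \<longleftrightarrow> True"
| "wf_qf L (Rel R vs) \<longleftrightarrow> R \<in> symbols L \<and> length vs = arity L R"
| "wf_qf L (Neg \<psi>) \<longleftrightarrow> wf_qf L \<psi>"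
| "wf_qf L (Conj \<psi> \<chi>) \<longleftrightarrow> wf_qf L \<psi> \<and> wf_qf L \<chi>"

primrec sat :: "('a, 'r) struct \<Rightarrow> ('v \<Rightarrow> 'a) \<Rightarrow> ('r, 'v) qf \<Rightarrow> bool" where
  "sat M \<sigma> (Eq u v) \<longleftrightarrow> \<sigma> u = \<sigma> v"
| "sat M \<sigma> (Rel R vs) \<longleftrightarrow> map \<sigma> vs \<in> rel M R"
| "sat M \<sigma> (Neg \<psi>) \<longleftrightarrow> \<not> sat M \<sigma> \<psi>"
| "sat M \<sigma> (Conj \<psi> \<chi>) \<longleftrightarrow> sat M \<sigma> \<psi> \<and> sat M \<sigma> \<chi>"

text \<open>
  A partitioned formula: the variables \<open>0, \<dots>, xlen - 1\<close> form the tuple \<open>x\<close> and the variables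
  \<open>xlen, \<dots>, xlen + ylen - 1\<close> form the tuple \<open>y\<close>. As usual, entries of \<open>x\<close> and \<open>y\<close> need not
  occur in the formula.
\<close>

record 'r pformula =
  fm :: "('r, nat) qf"
  xlen :: nat
  ylen :: nat

definition is_pformula :: "'r language \<Rightarrow> 'r pformula \<Rightarrow> bool" where
  "is_pformula L \<phi> \<longleftrightarrow> wf_qf L (fm \<phi>) \<and> vars (fm \<phi>) \<subseteq> {..<xlen \<phi> + ylen \<phi>}"

definition is_box :: "'a set \<Rightarrow> nat \<Rightarrow> nat \<Rightarrow> nat \<Rightarrow> 'a list set \<Rightarrow> bool" where
  "is_box X l t m A \<longleftrightarrow> 1 \<le> l \<and> l \<le> t \<and>
     (\<exists>ks As. length ks = l \<and> length As = l \<and> sum_list ks = t \<and>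
        (\<forall>i<l. 1 \<le> ks ! i \<and> As ! i \<subseteq> tuples X (ks ! i) \<and> As ! i \<noteq> {} \<and>
               finite (As ! i) \<and> card (As ! i) = m) \<and>
        A = concat ` listset As)"

definition underlying :: "'a list set \<Rightarrow> 'a set" where
  "underlying A = (\<Union>a\<in>A. set a)"

definition shatters :: "'b set set \<Rightarrow> 'b set \<Rightarrow> bool" where
  "shatters \<F> A \<longleftrightarrow> {F \<inter> A | F. F \<in> \<F>} = Pow A"

definition defset :: "'r pformula \<Rightarrow> ('a, 'r) struct \<Rightarrow> 'a list \<Rightarrow> 'a list set" where
  "defset \<phi> M b = {a \<in> tuples (univ M) (ylen \<phi>). sat M (nth (b @ a)) (fm \<phi>)}"

definition deffam :: "'r pformula \<Rightarrow> ('a, 'r) struct \<Rightarrow> 'a list set set" where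
  "deffam \<phi> M = {defset \<phi> M b | b. b \<in> tuples (univ M) (xlen \<phi>)}"

definition VC_struct :: "nat \<Rightarrow> 'r pformula \<Rightarrow> ('a, 'r) struct \<Rightarrow> enat" where
  "VC_struct l \<phi> M =
     Sup {enat m | m. \<exists>A. is_box (univ M) l (ylen \<phi>) m A \<and> shatters (deffam \<phi> M) A}"

definition VC :: "nat \<Rightarrow> 'r pformula \<Rightarrow> ('a, 'r) struct set \<Rightarrow> enat" where
  "VC l \<phi> H = (SUP M\<in>H. VC_struct l \<phi> M)"

text \<open>
  Formulas with parameters have variables in \<open>nat + 'a\<close>: \<open>Inl i\<close> is the \<open>i\<close>-th variable and
  \<open>Inr c\<close> is the parameter \<open>c\<close>, which denotes itself.
\<close>

definition asg :: "'a list \<Rightarrow> nat + 'a \<Rightarrow> 'a" where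
  "asg b = case_sum (nth b) id"

definition inst :: "'r pformula \<Rightarrow> 'a list \<Rightarrow> ('r, nat + 'a) qf" where
  "inst \<phi> a = map_qf id (\<lambda>v. if v < xlen \<phi> then Inl v else Inr (a ! (v - xlen \<phi>))) (fm \<phi>)"

definition satisfies :: "('a, 'r) struct \<Rightarrow> 'a list \<Rightarrow> ('r, nat + 'a) qf set \<Rightarrow> bool" where
  "satisfies M b \<Gamma> \<longleftrightarrow> (\<forall>\<psi>\<in>\<Gamma>. sat M (asg b) \<psi>)"

text \<open>
  Consistency of a set of formulas in \<open>n\<close> variables with parameters in \<open>C\<close>. The formulas are
  quantifier-free and the language is relational, so a model can be cut down to the parameters and
  the values of the variables; hence, for \<open>C\<close> finite and \<open>'a\<close> infinite, models with universe in
  \<open>'a\<close> suffice.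
\<close>

definition consistent ::
    "'r language \<Rightarrow> nat \<Rightarrow> 'a set \<Rightarrow> ('r, nat + 'a) qf set \<Rightarrow> bool" where
  "consistent L n C \<Gamma> \<longleftrightarrow>
     (\<exists>M b. is_struct L M \<and> C \<subseteq> univ M \<and> b \<in> tuples (univ M) n \<and> satisfies M b \<Gamma>)"

definition max_consistent ::
    "'r language \<Rightarrow> nat \<Rightarrow> 'a set \<Rightarrow> ('r, nat + 'a) qf set \<Rightarrow> ('r, nat + 'a) qf set \<Rightarrow> bool" where
  "max_consistent L n C \<Delta> \<Gamma> \<longleftrightarrow>
     \<Gamma> \<subseteq> \<Delta> \<and> consistent L n C \<Gamma> \<and>
     (\<forall>\<Gamma>'. \<Gamma> \<subseteq> \<Gamma>' \<and> \<Gamma>' \<subseteq> \<Delta> \<and> consistent L n C \<Gamma>' \<longrightarrow> \<Gamma>' = \<Gamma>)"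

definition is_type ::
    "'r language \<Rightarrow> 'r pformula \<Rightarrow> 'a list set \<Rightarrow> ('r, nat + 'a) qf set \<Rightarrow> bool" where
  "is_type L \<phi> A p \<longleftrightarrow>
     max_consistent L (xlen \<phi>) (underlying A) (inst \<phi> ` A \<union> (\<lambda>a. Neg (inst \<phi> a)) ` A) p"

definition realizes ::
    "'r pformula \<Rightarrow> 'a list set \<Rightarrow> ('a, 'r) struct \<Rightarrow> 'a list \<Rightarrow> ('r, nat + 'a) qf set \<Rightarrow> bool" where
  "realizes \<phi> A M b p \<longleftrightarrow>
     A \<subseteq> tuples (univ M) (ylen \<phi>) \<and> b \<in> tuples (univ M) (xlen \<phi>) \<and> satisfies M b p"

definition types ::
    "'r language \<Rightarrow> ('a, 'r) struct set \<Rightarrow> 'r pformula \<Rightarrow> 'a list set \<Rightarrow> ('r, nat + 'a) qf set set"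
  where
  "types L H \<phi> A = {p. is_type L \<phi> A p \<and> (\<exists>M\<in>H. \<exists>b. realizes \<phi> A M b p)}"

text \<open>Complete quantifier-free types in the pure language of equality.\<close>

definition eq_types :: "'r language \<Rightarrow> nat \<Rightarrow> 'a list set \<Rightarrow> ('r, nat + 'a) qf set set" where
  "eq_types L n A =
     {\<rho>. max_consistent L n (underlying A)
           {\<psi>. rels \<psi> = {} \<and> vars \<psi> \<subseteq> Inl ` {..<n} \<union> Inr ` underlying A} \<rho>}"

text \<open>
  \<open>copy k i p\<close> is \<open>p\<close> written in the \<open>i\<close>-th disjoint copy of the first \<open>k\<close> variables.
\<close>

definition copy ::
    "nat \<Rightarrow> nat \<Rightarrow> ('r, nat + 'a) qf set \<Rightarrow> ('r, nat + 'a) qf set" where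
  "copy k i p = map_qf id (map_sum (\<lambda>v. i * k + v) id) ` p"

definition types_seq ::
    "'r language \<Rightarrow> ('a, 'r) struct set \<Rightarrow> 'r pformula \<Rightarrow> nat \<Rightarrow> 'a list set \<Rightarrow>
     ('r, nat + 'a) qf set \<Rightarrow> ('r, nat + 'a) qf set set" where
  "types_seq L H \<phi> m A \<rho> =
     {\<Union>i<m. copy (xlen \<phi>) i (p i) | p.
        (\<forall>i<m. p i \<in> types L H \<phi> A) \<and>
        (\<exists>M\<in>H. \<exists>b. (\<forall>i<m. realizes \<phi> A M (b i) (p i)) \<and> inj_on b {..<m} \<and>
           (\<forall>i<m. \<forall>j<m. i \<noteq> j \<longrightarrow> satisfies M (b i @ b j) \<rho>))}"

definition VC_star :: "'r language \<Rightarrow> nat \<Rightarrow> 'r pformula \<Rightarrow> ('a, 'r) struct set \<Rightarrow> enat" where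
  "VC_star L l \<phi> H =
     Sup {enat m | m. \<exists>A \<rho>. is_box UNIV l (ylen \<phi>) m A \<and> \<rho> \<in> eq_types L (2 * xlen \<phi>) A \<and>
            card (types_seq L H \<phi> m A \<rho>) = 2 ^ (m ^ (l + 1))}"

text \<open>
  For a class \<open>H\<close> we express that its dimension is infinite by the existence of a single formula of
  infinite dimension. The value \<open>SUP \<phi>. VC l \<phi> H\<close> cannot be used for this purpose: the formula
  \<open>x\<^sub>1 = y \<or> \<dots> \<or> x\<^sub>k = y\<close> has \<open>VC 1\<close> at least \<open>k\<close> on every structure with more than \<open>k\<close>
  elements, so for every \<open>H\<close> with arbitrarily large members this supremum is infinite. In contrast,
  if all relations are empty in all members of \<open>H\<close>, then \<open>\<rho>\<close> determines all the types involved and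
  \<open>VC_star L l \<phi> H \<le> 1\<close> for all \<open>\<phi>\<close>.
\<close>

definition VC_infinite :: "'r language \<Rightarrow> nat \<Rightarrow> ('a, 'r) struct set \<Rightarrow> bool" where
  "VC_infinite L l H \<longleftrightarrow> (\<exists>\<phi>. is_pformula L \<phi> \<and> l \<le> ylen \<phi> \<and> VC l \<phi> H = \<infinity>)"

definition VC_star_infinite :: "'r language \<Rightarrow> nat \<Rightarrow> ('a, 'r) struct set \<Rightarrow> bool" where
  "VC_star_infinite L l H \<longleftrightarrow> (\<exists>\<phi>. is_pformula L \<phi> \<and> l \<le> ylen \<phi> \<and> VC_star L l \<phi> H = \<infinity>)"

end

theory Submission
  imports Defs "HOL-Library.FuncSet"
begin

text \<open>
  The same formula witnesses both sides. A set of \<open>m\<close>-sequences of types of size \<open>2 ^ (m ^ (l + 1))\<close>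
  contains every sequence of subsets of the box, so one member of \<open>H\<close> realizes all subsets of a
  subbox of height \<open>n\<close> as soon as \<open>m \<ge> 2 ^ (n ^ l)\<close>.

  Conversely, a shattered box of large height contains many disjoint blocks of height \<open>m\<close>, on which
  all choices of one subset per block are realized. The realizing tuples may coincide with each
  other or with elements of the box in a disorderly way. Passing to fewer blocks, one first fixes the
  equalities within a tuple and then as many of its coordinates as possible, until some
  block has all its subsets realized by tuples whose remaining coordinates avoid any given small set.
  Choosing tuples greedily, any two of them then have one and the same equality type over the block.
\<close>

section \<open>Evaluation of quantifier-free formulas under renaming and instantiation\<close>

lemma sat_map_qf: "sat M \<sigma> (map_qf id f \<psi>) \<longleftrightarrow> sat M (\<sigma> \<circ> f) \<psi>"
  by (induction \<psi>) (auto simp: comp_def)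

lemma sat_cong: "(\<And>v. v \<in> vars \<psi> \<Longrightarrow> \<sigma> v = \<tau> v) \<Longrightarrow> sat M \<sigma> \<psi> \<longleftrightarrow> sat M \<tau> \<psi>"
proof (induction \<psi>)
  case (Rel R vs)
  then have "map \<sigma> vs = map \<tau> vs" by auto
  then show ?case by (metis sat.simps(2))
qed auto

text \<open>Without relation symbols, a formula sees an assignment only through the coincidences
  among its values, so even the structure may change. This later carries \<open>\<rho>\<close> from
  one reference pair of tuples to every other pair.\<close>

lemma sat_equality_cong:
  assumes "rels \<psi> = {}"
    and "\<And>u v. u \<in> vars \<psi> \<Longrightarrow> v \<in> vars \<psi> \<Longrightarrow> \<sigma> u = \<sigma> v \<longleftrightarrow> \<tau> u = \<tau> v"
  shows "sat M \<sigma> \<psi> \<longleftrightarrow> sat N \<tau> \<psi>"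
  using assms by (induction \<psi>) auto

lemma sat_inst:
  assumes "length b = xlen \<phi>"
  shows "sat M (asg b) (inst \<phi> a) \<longleftrightarrow> sat M (nth (b @ a)) (fm \<phi>)"
proof -
  have "asg b \<circ> (\<lambda>v. if v < xlen \<phi> then Inl v else Inr (a ! (v - xlen \<phi>))) = nth (b @ a)"
    using assms by (auto simp: asg_def nth_append fun_eq_iff)
  then show ?thesis by (simp add: inst_def sat_map_qf)
qed

text \<open>Only the values of \<open>\<sigma>\<close> on the \<open>i\<close>-th copy of the
  variables are prescribed, so a single assignment can serve all copies at once.\<close>

lemma sat_copy_inst:
  assumes "\<And>v. v < xlen \<phi> \<Longrightarrow> \<sigma> (Inl (i * xlen \<phi> + v)) = b ! v" and "\<And>c. \<sigma> (Inr c) = c"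
  shows "sat M \<sigma> (map_qf id (map_sum (\<lambda>v. i * xlen \<phi> + v) id) (inst \<phi> a)) \<longleftrightarrow>
    sat M (asg b) (inst \<phi> a)"
  unfolding sat_map_qf
  by (rule sat_cong) (use assms in \<open>auto simp: inst_def asg_def qf.set_map\<close>)

section \<open>Types as subsets of the box\<close>

definition trace :: "'r pformula \<Rightarrow> ('a, 'r) struct \<Rightarrow> 'a list set \<Rightarrow> 'a list \<Rightarrow> 'a list set" where
  "trace \<phi> M A b = defset \<phi> M b \<inter> A"

text \<open>\<open>S\<close> is meant to be the trace of a realizing tuple. For other
  \<open>S\<close> the set can be inconsistent, since different \<open>a\<close> may have the same
  instance.\<close>

definition subset_type :: "'r pformula \<Rightarrow> 'a list set \<Rightarrow> 'a list set \<Rightarrow> ('r, nat + 'a) qf set" where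
  "subset_type \<phi> A S = inst \<phi> ` S \<union> (\<lambda>a. Neg (inst \<phi> a)) ` (A - S)"

lemma mem_trace:
  assumes "A \<subseteq> tuples (univ M) (ylen \<phi>)" "b \<in> tuples X (xlen \<phi>)"
  shows "a \<in> trace \<phi> M A b \<longleftrightarrow> a \<in> A \<and> sat M (asg b) (inst \<phi> a)"
  using assms sat_inst[of b \<phi> M a] by (auto simp: trace_def defset_def tuples_def)

lemma underlying_subset: "A \<subseteq> tuples X n \<Longrightarrow> underlying A \<subseteq> X"
  by (auto simp: underlying_def tuples_def)

text \<open>A consistent extension inside \<open>\<Delta>\<close> cannot contain a formula false at
  \<open>b\<close>, because the theory of \<open>b\<close> already contains the opposite one. The
  disjunction in \<open>complete\<close> covers both uses: equality formulas are closed under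
  negation, whereas in the set for \<open>\<phi>\<close>-types a negated instance has only its
  unnegated form as opposite.\<close>

lemma max_consistent_theory:
  assumes "is_struct L M" "C \<subseteq> univ M" "b \<in> tuples (univ M) n"
    and complete: "\<And>\<psi>. \<psi> \<in> \<Delta> \<Longrightarrow> \<not> sat M (asg b) \<psi> \<Longrightarrow>
      Neg \<psi> \<in> \<Delta> \<or> (\<exists>\<chi>\<in>\<Delta>. \<psi> = Neg \<chi>)"
  shows "max_consistent L n C \<Delta> {\<psi> \<in> \<Delta>. sat M (asg b) \<psi>}"
  unfolding max_consistent_def
proof (intro conjI allI impI)
  show "consistent L n C {\<psi> \<in> \<Delta>. sat M (asg b) \<psi>}"
    using assms(1-3) by (auto simp: consistent_def satisfies_def)
next
  fix \<Gamma> assume \<Gamma>: "{\<psi> \<in> \<Delta>. sat M (asg b) \<psi>} \<subseteq> \<Gamma> \<and> \<Gamma> \<subseteq> \<Delta> \<and> consistent L n C \<Gamma>"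
  then obtain N c where N: "satisfies N c \<Gamma>" by (auto simp: consistent_def)
  have "sat M (asg b) \<psi>" if "\<psi> \<in> \<Gamma>" for \<psi>
  proof (rule ccontr)
    assume not: "\<not> sat M (asg b) \<psi>"
    have "\<psi> \<in> \<Delta>" using that \<Gamma> by auto
    from complete[OF this not] show False
    proof
      assume "Neg \<psi> \<in> \<Delta>"
      then have "Neg \<psi> \<in> \<Gamma>" using not \<Gamma> by auto
      then show False using N that unfolding satisfies_def by (metis sat.simps(3))
    next
      assume "\<exists>\<chi>\<in>\<Delta>. \<psi> = Neg \<chi>"
      then obtain \<chi> where "\<chi> \<in> \<Delta>" "\<psi> = Neg \<chi>" by auto
      then have "\<chi> \<in> \<Gamma>" using not \<Gamma> by auto
      then show False using N that \<open>\<psi> = Neg \<chi>\<close> unfolding satisfies_def by (metis sat.simps(3))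
    qed
  qed
  then show "\<Gamma> = {\<psi> \<in> \<Delta>. sat M (asg b) \<psi>}" using \<Gamma> by auto
qed auto

text \<open>Being satisfied by \<open>b\<close>, \<open>\<Gamma>\<close> lies inside the theory of
  \<open>b\<close>, which is consistent, so maximality forces equality.\<close>

lemma max_consistent_unique:
  assumes "is_struct L M" "C \<subseteq> univ M" "b \<in> tuples (univ M) n"
    and "max_consistent L n C \<Delta> \<Gamma>" "satisfies M b \<Gamma>"
  shows "\<Gamma> = {\<psi> \<in> \<Delta>. sat M (asg b) \<psi>}"
proof -
  have "consistent L n C {\<psi> \<in> \<Delta>. sat M (asg b) \<psi>}"
    using assms(1-3) by (auto simp: consistent_def satisfies_def)
  moreover have "\<Gamma> \<subseteq> {\<psi> \<in> \<Delta>. sat M (asg b) \<psi>}"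
    using assms(4,5) by (auto simp: max_consistent_def satisfies_def)
  ultimately show ?thesis using assms(4) unfolding max_consistent_def by blast
qed

text \<open>The instances and negated instances true at \<open>b\<close> form the only
  \<open>\<phi>\<close>-type that \<open>b\<close> satisfies. From here on, types are handled as
  subsets of \<open>A\<close>.\<close>

lemma is_type_realized_iff:
  assumes "is_struct L M" "A \<subseteq> tuples (univ M) (ylen \<phi>)" "b \<in> tuples (univ M) (xlen \<phi>)"
  shows "is_type L \<phi> A p \<and> satisfies M b p \<longleftrightarrow> p = subset_type \<phi> A (trace \<phi> M A b)"
proof -
  let ?\<Delta> = "inst \<phi> ` A \<union> (\<lambda>a. Neg (inst \<phi> a)) ` A"
  let ?p = "{\<psi> \<in> ?\<Delta>. sat M (asg b) \<psi>}"
  have "?p = subset_type \<phi> A (trace \<phi> M A b)"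
  proof -
    have "?p = inst \<phi> ` {a \<in> A. sat M (asg b) (inst \<phi> a)} \<union>
        (\<lambda>a. Neg (inst \<phi> a)) ` {a \<in> A. \<not> sat M (asg b) (inst \<phi> a)}"
      by auto
    also have "{a \<in> A. sat M (asg b) (inst \<phi> a)} = trace \<phi> M A b"
      using mem_trace[OF assms(2,3)] by blast
    also have "{a \<in> A. \<not> sat M (asg b) (inst \<phi> a)} = A - trace \<phi> M A b"
      using mem_trace[OF assms(2,3)] by blast
    finally show ?thesis unfolding subset_type_def .
  qed
  moreover have "is_type L \<phi> A ?p"
    unfolding is_type_def
    by (rule max_consistent_theory) (use assms in \<open>auto simp: underlying_subset\<close>)
  moreover have "satisfies M b ?p" by (simp add: satisfies_def)
  moreover have "p = ?p" if "is_type L \<phi> A p" "satisfies M b p"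
    by (rule max_consistent_unique[OF assms(1) underlying_subset[OF assms(2)] assms(3)
          that(1)[unfolded is_type_def] that(2)])
  ultimately show ?thesis by metis
qed

text \<open>The semantic side of \<open>types_seq\<close>: each type is replaced by the subset of
  the box that codes it, and \<open>\<rho>\<close> is the only syntax left.\<close>

definition realizable ::
    "('a, 'r) struct set \<Rightarrow> 'r pformula \<Rightarrow> nat \<Rightarrow> 'a list set \<Rightarrow> ('r, nat + 'a) qf set \<Rightarrow>
     (nat \<Rightarrow> 'a list set) \<Rightarrow> bool" where
  "realizable H \<phi> m A \<rho> s \<longleftrightarrow> (\<exists>M\<in>H. \<exists>b. A \<subseteq> tuples (univ M) (ylen \<phi>) \<and>
     (\<forall>i<m. b i \<in> tuples (univ M) (xlen \<phi>) \<and> trace \<phi> M A (b i) = s i) \<and> inj_on b {..<m} \<and>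
     (\<forall>i<m. \<forall>j<m. i \<noteq> j \<longrightarrow> satisfies M (b i @ b j) \<rho>))"

definition seq_type ::
    "'r pformula \<Rightarrow> nat \<Rightarrow> 'a list set \<Rightarrow> (nat \<Rightarrow> 'a list set) \<Rightarrow> ('r, nat + 'a) qf set" where
  "seq_type \<phi> m A s = (\<Union>i<m. copy (xlen \<phi>) i (subset_type \<phi> A (s i)))"

lemma types_seq_eq:
  assumes "\<forall>M\<in>H. is_struct L M" and "0 < m"
  shows "types_seq L H \<phi> m A \<rho> =
    seq_type \<phi> m A ` {s \<in> {..<m} \<rightarrow>\<^sub>E Pow A. realizable H \<phi> m A \<rho> s}" (is "?l = ?r")
proof (intro equalityI subsetI)
  fix q assume "q \<in> ?l"
  then obtain p M b where q: "q = (\<Union>i<m. copy (xlen \<phi>) i (p i))"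
    and p: "\<forall>i<m. p i \<in> types L H \<phi> A" and M: "M \<in> H"
    and b: "\<forall>i<m. realizes \<phi> A M (b i) (p i)" "inj_on b {..<m}"
      "\<forall>i<m. \<forall>j<m. i \<noteq> j \<longrightarrow> satisfies M (b i @ b j) \<rho>"
    unfolding types_seq_def by blast
  let ?s = "restrict (\<lambda>i. trace \<phi> M A (b i)) {..<m}"
  have "p i = subset_type \<phi> A (?s i)" if "i < m" for i
    using is_type_realized_iff[of L M A \<phi> "b i" "p i"] that p b(1) M assms(1)
    by (auto simp: realizes_def types_def)
  then have "q = seq_type \<phi> m A ?s" unfolding q seq_type_def by auto
  moreover have "?s \<in> {..<m} \<rightarrow>\<^sub>E Pow A" by (auto simp: trace_def)
  \<comment> \<open>That \<open>A\<close> consists of tuples of \<open>M\<close> is only recorded in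
    \<open>realizes\<close>, so at least one index is required; this is where \<open>0 < m\<close>
    enters.\<close>
  moreover have "realizable H \<phi> m A \<rho> ?s"
    unfolding realizable_def
    by (rule bexI[OF _ M], rule exI[of _ b]) (use b assms(2) in \<open>auto simp: realizes_def\<close>)
  ultimately show "q \<in> ?r" by auto
next
  fix q assume "q \<in> ?r"
  then obtain s M b where q: "q = seq_type \<phi> m A s" and M: "M \<in> H"
    and A: "A \<subseteq> tuples (univ M) (ylen \<phi>)"
    and b: "\<forall>i<m. b i \<in> tuples (univ M) (xlen \<phi>) \<and> trace \<phi> M A (b i) = s i" "inj_on b {..<m}"
      "\<forall>i<m. \<forall>j<m. i \<noteq> j \<longrightarrow> satisfies M (b i @ b j) \<rho>"
    unfolding realizable_def by blast
  have p: "is_type L \<phi> A (subset_type \<phi> A (s i))" "realizes \<phi> A M (b i) (subset_type \<phi> A (s i))"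
    if "i < m" for i
    using is_type_realized_iff[of L M A \<phi> "b i" "subset_type \<phi> A (s i)"] that A b(1) M assms(1)
    by (auto simp: realizes_def)
  then have "subset_type \<phi> A (s i) \<in> types L H \<phi> A" if "i < m" for i
    using M that unfolding types_def by blast
  then show "q \<in> ?l"
    unfolding types_seq_def q seq_type_def mem_Collect_eq using p b
    by (intro exI[of _ "\<lambda>i. subset_type \<phi> A (s i)"] conjI bexI[OF _ M] exI[of _ b]) simp_all
qed

text \<open>
  The copies of two sets of formulas can overlap when \<open>x\<close> does not occur in \<open>\<phi>\<close>, so injectivity
  is proved semantically, through a joint assignment for all copies.
\<close>

lemma seq_type_subset:
  assumes "realizable H \<phi> m A \<rho> s'" and eq: "seq_type \<phi> m A s = seq_type \<phi> m A s'" and "i < m"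
    and "s i \<subseteq> A"
  shows "s i \<subseteq> s' i"
proof
  fix a assume a: "a \<in> s i"
  let ?k = "xlen \<phi>"
  obtain M b where A: "A \<subseteq> tuples (univ M) (ylen \<phi>)"
    and b: "\<And>i. i < m \<Longrightarrow> b i \<in> tuples (univ M) ?k \<and> trace \<phi> M A (b i) = s' i"
    using assms(1) unfolding realizable_def by blast
  \<comment> \<open>Division with remainder decodes variable \<open>i * ?k + v\<close> as entry
    \<open>v\<close> of \<open>b i\<close>. If \<open>?k = 0\<close>, the values on
    \<open>Inl\<close> are irrelevant, since instances then mention parameters only.\<close>
  define \<sigma> where "\<sigma> = case_sum (\<lambda>n. b (n div ?k) ! (n mod ?k)) id"
  have \<sigma>: "sat M \<sigma> (map_qf id (map_sum (\<lambda>v. j * ?k + v) id) (inst \<phi> c)) \<longleftrightarrow>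
      sat M (asg (b j)) (inst \<phi> c)" for j c
    by (rule sat_copy_inst) (auto simp: \<sigma>_def)
  have "sat M \<sigma> \<psi>" if \<psi>: "\<psi> \<in> seq_type \<phi> m A s'" for \<psi>
  proof -
    obtain j \<chi> where j: "j < m" "\<chi> \<in> subset_type \<phi> A (s' j)"
      "\<psi> = map_qf id (map_sum (\<lambda>v. j * ?k + v) id) \<chi>"
      using \<psi> unfolding seq_type_def copy_def by blast
    have "c \<in> s' j \<longleftrightarrow> c \<in> A \<and> sat M (asg (b j)) (inst \<phi> c)" for c
      using mem_trace[OF A, of "b j" "univ M" c] b[OF j(1)] by auto
    then show ?thesis using j \<sigma> by (auto simp: subset_type_def)
  qed
  moreover have "map_qf id (map_sum (\<lambda>v. i * ?k + v) id) (inst \<phi> a) \<in> seq_type \<phi> m A s"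
    using a \<open>i < m\<close> by (auto simp: seq_type_def copy_def subset_type_def)
  ultimately have "sat M (asg (b i)) (inst \<phi> a)" using eq \<sigma> by blast
  then show "a \<in> s' i" using mem_trace[OF A, of "b i" "univ M" a] b[OF \<open>i < m\<close>] a assms(4) by auto
qed

text \<open>There are \<open>(2 ^ (m ^ l)) ^ m\<close> sequences of subsets of \<open>A\<close>,
  exactly the required number. As distinct realizable sequences give distinct types, the count is
  reached only if no sequence is missing.\<close>

lemma card_types_seq_iff:
  assumes "\<forall>M\<in>H. is_struct L M" "0 < m" "finite A" "card A = m ^ l"
  shows "card (types_seq L H \<phi> m A \<rho>) = 2 ^ (m ^ (l + 1)) \<longleftrightarrow>
    (\<forall>s \<in> {..<m} \<rightarrow>\<^sub>E Pow A. realizable H \<phi> m A \<rho> s)"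
proof -
  let ?P = "{..<m} \<rightarrow>\<^sub>E Pow A" and ?R = "{s \<in> {..<m} \<rightarrow>\<^sub>E Pow A. realizable H \<phi> m A \<rho> s}"
  have fin: "finite ?P" using assms(3) by (auto intro: finite_PiE)
  have "card ?P = 2 ^ (m ^ (l + 1))"
    using assms by (simp add: card_PiE card_Pow power_mult[symmetric] mult.commute)
  moreover have "inj_on (seq_type \<phi> m A) ?R"
  proof (rule inj_onI)
    fix s s' assume s: "s \<in> ?R" "s' \<in> ?R" "seq_type \<phi> m A s = seq_type \<phi> m A s'"
    show "s = s'"
    proof (rule PiE_ext)
      show "s \<in> {..<m} \<rightarrow>\<^sub>E Pow A" "s' \<in> {..<m} \<rightarrow>\<^sub>E Pow A" using s by auto
      fix i assume i: "i \<in> {..<m}"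
      have "s i \<subseteq> A" "s' i \<subseteq> A" using s i by (auto simp: PiE_def Pi_def)
      then show "s i = s' i"
        using seq_type_subset[of H \<phi> m A \<rho> s' s i] seq_type_subset[of H \<phi> m A \<rho> s s' i] s i by auto
    qed
  qed
  ultimately have "card (types_seq L H \<phi> m A \<rho>) = 2 ^ (m ^ (l + 1)) \<longleftrightarrow> card ?R = card ?P"
    unfolding types_seq_eq[OF assms(1,2)] by (simp add: card_image)
  also have "\<dots> \<longleftrightarrow> ?R = ?P" using card_subset_eq[OF fin, of ?R] by auto
  finally show ?thesis by blast
qed

section \<open>Boxes\<close>

definition box_sides :: "'a set \<Rightarrow> nat list \<Rightarrow> nat \<Rightarrow> 'a list set list \<Rightarrow> bool" where
  "box_sides X ks m As \<longleftrightarrow> length As = length ks \<and>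
     (\<forall>i<length ks. 1 \<le> ks ! i \<and> As ! i \<subseteq> tuples X (ks ! i) \<and> As ! i \<noteq> {} \<and>
        finite (As ! i) \<and> card (As ! i) = m)"

lemma is_box_iff:
  "is_box X l t m A \<longleftrightarrow> 1 \<le> l \<and> l \<le> t \<and>
     (\<exists>ks As. length ks = l \<and> sum_list ks = t \<and> box_sides X ks m As \<and> A = concat ` listset As)"
  unfolding is_box_def box_sides_def by blast

lemma mem_listset: "xs \<in> listset As \<longleftrightarrow> list_all2 (\<in>) xs As"
  by (induction As arbitrary: xs) (auto simp: set_Cons_def list_all2_Cons2)

lemma card_listset:
  assumes "\<forall>A\<in>set As. finite A"
  shows "finite (listset As) \<and> card (listset As) = prod_list (map card As)"
  using assms
proof (induction As)
  case (Cons A As)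
  have "set_Cons A (listset As) = (\<lambda>(x, xs). x # xs) ` (A \<times> listset As)"
    by (auto simp: set_Cons_def)
  moreover have "inj_on (\<lambda>(x, xs). x # xs) (A \<times> listset As)" by (auto simp: inj_on_def)
  ultimately show ?case using Cons by (simp add: card_image card_cartesian_product)
qed auto

lemma concat_inject_lengths:
  "map length xs = map length ys \<Longrightarrow> concat xs = concat ys \<Longrightarrow> xs = ys"
proof (induction xs arbitrary: ys)
  case (Cons x xs) then show ?case by (cases ys) auto
qed auto

lemma listset_lengths:
  assumes "box_sides X ks m As" "xs \<in> listset As"
  shows "map length xs = ks"
proof (rule nth_equalityI)
  show "length (map length xs) = length ks"
    using assms by (simp add: mem_listset list_all2_conv_all_nth box_sides_def)
  fix i assume "i < length (map length xs)"
  then have "i < length ks" "xs ! i \<in> As ! i" "As ! i \<subseteq> tuples X (ks ! i)" "i < length xs"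
    using assms by (auto simp: mem_listset list_all2_conv_all_nth box_sides_def)
  then show "map length xs ! i = ks ! i" by (auto simp: tuples_def)
qed

text \<open>Concatenation is injective on the product of the sides because the lengths of the
  factors are fixed by \<open>ks\<close>.\<close>

lemma card_box:
  assumes "box_sides X ks m As"
  shows "finite (concat ` listset As)" "card (concat ` listset As) = m ^ length ks"
proof -
  have "\<forall>A\<in>set As. finite A" using assms by (auto simp: box_sides_def in_set_conv_nth)
  moreover have "map card As = replicate (length ks) m"
    using assms by (auto simp: box_sides_def intro!: nth_equalityI)
  ultimately have "finite (listset As)" "card (listset As) = m ^ length ks"
    using card_listset[of As] by auto
  moreover have "inj_on concat (listset As)"
    using listset_lengths[OF assms] by (intro inj_onI) (metis concat_inject_lengths)
  ultimately show "finite (concat ` listset As)" "card (concat ` listset As) = m ^ length ks"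
    by (auto simp: card_image)
qed

lemma box_subset_tuples:
  assumes "box_sides X ks m As"
  shows "concat ` listset As \<subseteq> tuples X (sum_list ks)"
proof
  fix a assume "a \<in> concat ` listset As"
  then obtain xs where xs: "xs \<in> listset As" "a = concat xs" by auto
  have "length a = sum_list ks" using listset_lengths[OF assms xs(1)] xs(2) by (simp add: length_concat)
  moreover have "set a \<subseteq> X"
    using xs assms
    by (fastforce simp: mem_listset list_all2_conv_all_nth box_sides_def tuples_def in_set_conv_nth)
  ultimately show "a \<in> tuples X (sum_list ks)" by (simp add: tuples_def)
qed

text \<open>Every element of a side occurs as a factor of some tuple of the box, because the other
  sides are nonempty. This moves a box given over \<open>UNIV\<close> into the universe of a
  structure.\<close>

lemma box_sides_restrict:
  assumes "box_sides X ks m As" "concat ` listset As \<subseteq> tuples Y n"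
  shows "box_sides Y ks m As"
proof -
  have "set a \<subseteq> Y" if i: "i < length As" "a \<in> As ! i" for i a
  proof -
    \<comment> \<open>Arbitrary elements of the other sides complete \<open>a\<close> to a tuple of
      the box.\<close>
    define xs where "xs = (map (\<lambda>A. SOME x. x \<in> A) As)[i := a]"
    have "xs \<in> listset As"
      using assms(1) i
      by (auto simp: xs_def mem_listset list_all2_conv_all_nth box_sides_def nth_list_update
          some_in_eq)
    then have "concat xs \<in> tuples Y n" using assms(2) by blast
    then have "set (concat xs) \<subseteq> Y" by (simp add: tuples_def)
    moreover have "a \<in> set xs" using i by (auto simp: xs_def set_update_memI)
    ultimately show ?thesis by auto
  qed
  then show ?thesis using assms(1) by (auto simp: box_sides_def tuples_def subset_iff)
qed

text \<open>Enumerate \<open>Q\<close> and cut the indices into consecutive intervals of length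
  \<open>n\<close>.\<close>

lemma disjoint_subsets:
  assumes "k * n \<le> card Q"
  shows "\<exists>D. (\<forall>t<k. D t \<subseteq> Q \<and> card (D t) = n) \<and> (\<forall>t<k. \<forall>t'<k. t \<noteq> t' \<longrightarrow> D t \<inter> D t' = {})"
proof (cases "finite Q")
  case True
  then obtain h where h: "bij_betw h {0..<card Q} Q" using ex_bij_betw_nat_finite by blast
  let ?J = "\<lambda>t. {t * n..<t * n + n}"
  have J: "?J t \<subseteq> {0..<card Q}" if "t < k" for t
  proof -
    have "Suc t * n \<le> k * n" using that by (intro mult_le_mono1) auto
    then show ?thesis using assms by auto
  qed
  have disj: "?J t \<inter> ?J t' = {}" if "t < t'" for t t'
  proof -
    have "Suc t * n \<le> t' * n" using that by (intro mult_le_mono1) auto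
    then show ?thesis by auto
  qed
  show ?thesis
  proof (intro exI conjI allI impI)
    fix t assume t: "t < k"
    show "h ` ?J t \<subseteq> Q" using J[OF t] h by (auto simp: bij_betw_def)
    have "inj_on h (?J t)" using h J[OF t] by (meson bij_betw_def inj_on_subset)
    then show "card (h ` ?J t) = n" by (simp add: card_image)
    fix t' assume t': "t' < k" "t \<noteq> t'"
    then have "?J t \<inter> ?J t' = {}" using disj[of t t'] disj[of t' t] by (cases "t < t'") auto
    then show "h ` ?J t \<inter> h ` ?J t' = {}"
      using h J[OF t] J[OF t'(1)] inj_on_image_Int[of h "{0..<card Q}" "?J t" "?J t'"]
      by (metis bij_betw_def image_empty)
  qed
next
  case False
  \<comment> \<open>An infinite \<open>Q\<close> has \<open>card Q = 0\<close>, so either no pieces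
    or only empty ones are asked for.\<close>
  then have "k = 0 \<or> n = 0" using assms by auto
  then show ?thesis by (intro exI[of _ "\<lambda>_. {}"]) auto
qed

text \<open>Cut every side into \<open>k\<close> disjoint pieces; the \<open>t\<close>-th box is the
  product of the \<open>t\<close>-th pieces. A common tuple of two boxes would have the same factors
  in both, contradicting disjointness already on the first side, which exists as
  \<open>ks \<noteq> []\<close>.\<close>

lemma disjoint_subboxes:
  assumes "box_sides X ks m As" "k * n \<le> m" "1 \<le> n" "ks \<noteq> []"
  obtains Bs where "\<And>t. t < k \<Longrightarrow> box_sides X ks n (Bs t)"
    "\<And>t. t < k \<Longrightarrow> concat ` listset (Bs t) \<subseteq> concat ` listset As"
    "\<And>t t'. t < k \<Longrightarrow> t' < k \<Longrightarrow> t \<noteq> t' \<Longrightarrow> concat ` listset (Bs t) \<inter> concat ` listset (Bs t') = {}"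
proof -
  define good where "good i D \<longleftrightarrow> (\<forall>t<k. D t \<subseteq> As ! i \<and> card (D t) = n) \<and>
      (\<forall>t<k. \<forall>t'<k. t \<noteq> t' \<longrightarrow> D t \<inter> D t' = {})" for i and D :: "nat \<Rightarrow> 'a list set"
  have "\<exists>D. good i D" if "i < length ks" for i
    using disjoint_subsets[of k n "As ! i"] assms(1,2) that unfolding good_def box_sides_def by simp
  moreover define D where "D i = (SOME D. good i D)" for i
  ultimately have good: "good i (D i)" if "i < length ks" for i
    using that by (metis someI_ex)
  have D: "\<And>i t. i < length ks \<Longrightarrow> t < k \<Longrightarrow> D i t \<subseteq> As ! i \<and> card (D i t) = n"
    "\<And>i t t'. i < length ks \<Longrightarrow> t < k \<Longrightarrow> t' < k \<Longrightarrow> t \<noteq> t' \<Longrightarrow> D i t \<inter> D i t' = {}"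
    using good unfolding good_def by blast+
  define Bs where "Bs t = map (\<lambda>i. D i t) [0..<length ks]" for t
  have sides: "box_sides X ks n (Bs t)" if t: "t < k" for t
    unfolding box_sides_def
  proof (intro conjI allI impI)
    fix i assume i: "i < length ks"
    have "finite (D i t)" using D(1)[OF i t] assms(3) by (metis card.infinite not_one_le_zero)
    moreover have "D i t \<noteq> {}" using D(1)[OF i t] assms(3) by auto
    ultimately show "1 \<le> ks ! i" "Bs t ! i \<subseteq> tuples X (ks ! i)" "Bs t ! i \<noteq> {}"
      "finite (Bs t ! i)" "card (Bs t ! i) = n"
      using D(1)[OF i t] i assms(1) by (auto simp: Bs_def box_sides_def)
  qed (simp add: Bs_def)
  have sub: "concat ` listset (Bs t) \<subseteq> concat ` listset As" if "t < k" for t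
    using D(1) that assms(1)
    by (intro image_mono)
      (fastforce simp: Bs_def mem_listset list_all2_conv_all_nth box_sides_def)
  have disj: "concat ` listset (Bs t) \<inter> concat ` listset (Bs t') = {}"
    if t: "t < k" "t' < k" "t \<noteq> t'" for t t'
  proof (rule ccontr)
    assume "\<not> ?thesis"
    then obtain xs ys where xs: "xs \<in> listset (Bs t)" "ys \<in> listset (Bs t')" "concat xs = concat ys"
      by auto
    then have "xs = ys"
      using listset_lengths[OF sides] t by (metis concat_inject_lengths)
    then have "xs ! 0 \<in> D 0 t \<inter> D 0 t'"
      using xs assms(4) by (auto simp: mem_listset list_all2_conv_all_nth Bs_def)
    then show False using D(2)[of 0 t t'] t assms(4) by auto
  qed
  show thesis by (rule that[of Bs]) (use sides sub disj in blast)+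
qed

section \<open>Full families\<close>

text \<open>In the application the blocks in \<open>I\<close> are disjoint subboxes,
  \<open>tr t\<close> takes the trace on block \<open>t\<close>, and \<open>P t\<close> is its power
  set. Only the independence of the blocks matters for the combinatorics.\<close>

definition full :: "('t \<Rightarrow> 'b \<Rightarrow> 's) \<Rightarrow> ('t \<Rightarrow> 's set) \<Rightarrow> 't set \<Rightarrow> 'b set \<Rightarrow> bool" where
  "full tr P I F \<longleftrightarrow> (\<forall>f \<in> Pi I P. \<exists>b\<in>F. \<forall>t\<in>I. tr t b = f t)"

lemma full_mono: "full tr P I F \<Longrightarrow> F \<subseteq> G \<Longrightarrow> full tr P I G"
  unfolding full_def by blast

lemma full_restrict:
  assumes "full tr P I F" "J \<subseteq> I" "f \<in> Pi J P"
  shows "full tr P (I - J) {b \<in> F. \<forall>t\<in>J. tr t b = f t}"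
  unfolding full_def
proof
  fix g assume g: "g \<in> Pi (I - J) P"
  let ?h = "\<lambda>t. if t \<in> J then f t else g t"
  have "?h \<in> Pi I P" using assms(2,3) g by (auto simp: Pi_def)
  then obtain b where "b \<in> F" "\<forall>t\<in>I. tr t b = ?h t" using assms(1) by (auto simp: full_def)
  then show "\<exists>b\<in>{b \<in> F. \<forall>t\<in>J. tr t b = f t}. \<forall>t\<in>I - J. tr t b = g t"
    using assms(2) by (intro bexI[of _ b]) auto
qed

text \<open>
  If colour \<open>c\<close> misses some choice on a set \<open>J\<close> of blocks, then fixing that choice on \<open>J\<close> eliminates
  the colour \<open>c\<close> and leaves a family that is full on the other blocks.
\<close>

lemma full_cover:
  assumes "finite C" "full tr P I F" "finite I" "N * card C \<le> card I" "F \<subseteq> (\<Union>c\<in>C. G c)"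
    and "\<And>t. t \<in> I \<Longrightarrow> P t \<noteq> {}"
  shows "\<exists>c\<in>C. \<exists>J\<subseteq>I. card J = N \<and> full tr P J (F \<inter> G c)"
  using assms
proof (induction C arbitrary: I F rule: finite_induct)
  case empty
  \<comment> \<open>Without colours \<open>F\<close> is empty, yet fullness yields a member as soon
    as some choice function exists.\<close>
  have "(\<lambda>t. SOME x. x \<in> P t) \<in> Pi I P" using empty.prems(5) by (auto simp: some_in_eq)
  then show ?case using empty.prems by (auto simp: full_def)
next
  case (insert c C)
  have "N \<le> card I" using insert by simp
  then obtain J where J: "J \<subseteq> I" "card J = N" using obtain_subset_with_card_n by metis
  show ?case
  proof (cases "full tr P J (F \<inter> G c)")
    case True then show ?thesis using J by auto
  next
    case False
    then obtain f where f: "f \<in> Pi J P" "\<not> (\<exists>b\<in>F \<inter> G c. \<forall>t\<in>J. tr t b = f t)"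
      by (auto simp: full_def)
    let ?F = "{b \<in> F. \<forall>t\<in>J. tr t b = f t}"
    \<comment> \<open>Eliminating one colour costs \<open>N\<close> blocks, and \<open>N\<close>
      remain for each other colour.\<close>
    have "N * card C \<le> card (I - J)"
      using insert.hyps insert.prems(2,3) J by (simp add: card_Diff_subset finite_subset)
    moreover have "?F \<subseteq> (\<Union>c\<in>C. G c)" using f insert.prems(4) by auto
    ultimately have "\<exists>c\<in>C. \<exists>J'\<subseteq>I - J. card J' = N \<and> full tr P J' (?F \<inter> G c)"
      using full_restrict[OF insert.prems(1) J(1) f(1)] insert.prems(2,5)
      by (intro insert.IH) auto
    then obtain c' J' where c': "c' \<in> C" "J' \<subseteq> I - J" "card J' = N" "full tr P J' (?F \<inter> G c')"
      by blast
    have "full tr P J' (F \<inter> G c')" by (rule full_mono[OF c'(4)]) auto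
    moreover have "J' \<subseteq> I" using c'(2) by auto
    ultimately show ?thesis using c'(1,3) by blast
  qed
qed

section \<open>Families with constant coordinates whose other coordinates avoid small sets\<close>

definition constant_on_coords :: "nat set \<Rightarrow> 'a list set \<Rightarrow> bool" where
  "constant_on_coords V F \<longleftrightarrow> (\<forall>u\<in>V. \<forall>b\<in>F. \<forall>b'\<in>F. b ! u = b' ! u)"

text \<open>\<open>K\<close> is a budget fixed in advance. It has to cover the box entries, the
  constant values and the entries of all tuples chosen before.\<close>

definition avoiding :: "('a list \<Rightarrow> 's) \<Rightarrow> 's set \<Rightarrow> nat \<Rightarrow> nat set \<Rightarrow> 'a list set \<Rightarrow> bool" where
  "avoiding tr P K W F \<longleftrightarrow> (\<forall>T\<in>P. \<forall>E. finite E \<and> card E \<le> K \<longrightarrow>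
     (\<exists>b\<in>F. tr b = T \<and> (\<forall>u\<in>W. b ! u \<notin> E)))"

text \<open>
  Either a block works with the current set \<open>V\<close> of constant coordinates, or some choice on it forces
  a further coordinate into a set of at most \<open>K\<close> values, and then \<open>full_cover\<close> makes that coordinate
  constant as well.
\<close>

lemma generic_block:
  fixes F :: "'a list set"
  assumes "full tr P I F" "finite I" "(d * K + 1) ^ w \<le> card I"
    and "V \<subseteq> {..<d}" "card ({..<d} - V) = w" "constant_on_coords V F"
    and "\<And>t. t \<in> I \<Longrightarrow> P t \<noteq> {}"
  shows "\<exists>t\<in>I. \<exists>F'\<subseteq>F. \<exists>V'\<subseteq>{..<d}. constant_on_coords V' F' \<and>
    avoiding (tr t) (P t) K ({..<d} - V') F'"
  using assms
proof (induction w arbitrary: I F V)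
  case 0
  then obtain t where t: "t \<in> I" by fastforce
  \<comment> \<open>All coordinates are constant, so there is nothing to avoid and one block with
    all its choices realized suffices.\<close>
  have W: "{..<d} - V = {}" using 0 by (metis card_0_eq finite_Diff finite_lessThan)
  have "\<exists>b\<in>F. tr t b = T" if "T \<in> P t" for T
  proof -
    have "(\<lambda>i. if i = t then T else SOME x. x \<in> P i) \<in> Pi I P"
      using that "0.prems"(7) by (auto simp: some_in_eq)
    then show ?thesis using "0.prems"(1) t by (fastforce simp: full_def)
  qed
  then have "avoiding (tr t) (P t) K ({..<d} - V) F" unfolding W avoiding_def by blast
  then show ?case using t "0.prems"(4,6) by blast
next
  case (Suc w)
  have "0 < card I" using Suc.prems(3) by (metis Suc_eq_plus1 less_le_trans zero_less_Suc zero_less_power)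
  then obtain t where t: "t \<in> I" by fastforce
  show ?case
  proof (cases "avoiding (tr t) (P t) K ({..<d} - V) F")
    case True then show ?thesis using t Suc.prems(4,6) by blast
  next
    case False
    then obtain T E where T: "T \<in> P t" "finite E" "card E \<le> K"
      "\<And>b. b \<in> F \<Longrightarrow> tr t b = T \<Longrightarrow> \<exists>u\<in>{..<d} - V. b ! u \<in> E"
      unfolding avoiding_def by blast
    \<comment> \<open>Once \<open>T\<close> is fixed on block \<open>t\<close>, every remaining
      tuple has a value \<open>e\<close> from \<open>E\<close> at some non-constant coordinate
      \<open>u\<close>. The pairs \<open>(u, e)\<close> are the colours.\<close>
    let ?F = "{b \<in> F. \<forall>s\<in>{t}. tr s b = T}" and ?C = "({..<d} - V) \<times> E"
    have full: "full tr P (I - {t}) ?F"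
      using full_restrict[OF Suc.prems(1), of "{t}" "\<lambda>_. T"] t T(1) by auto
    have "card ?C \<le> d * K"
    proof -
      have "card ({..<d} - V) \<le> d" by (metis card_lessThan card_mono Diff_subset finite_lessThan)
      then show ?thesis using T(3) by (auto simp: card_cartesian_product intro: mult_le_mono)
    qed
    then have "(d * K + 1) ^ w * card ?C \<le> (d * K + 1) ^ w * (d * K)" by simp
    \<comment> \<open>The summand \<open>1\<close> in the base pays for block \<open>t\<close>,
      which was spent on fixing \<open>T\<close>.\<close>
    also have "\<dots> \<le> (d * K + 1) ^ Suc w - 1"
    proof -
      have "(d * K + 1) ^ w * (d * K) + 1 \<le> (d * K + 1) ^ w * (d * K) + (d * K + 1) ^ w"
        by (intro add_left_mono) simp
      also have "\<dots> = (d * K + 1) ^ Suc w" by (simp add: algebra_simps)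
      finally show ?thesis by (rule add_le_imp_le_diff)
    qed
    also have "\<dots> \<le> card (I - {t})" using Suc.prems(2,3) t by simp
    finally have card: "(d * K + 1) ^ w * card ?C \<le> card (I - {t})" .
    have "\<exists>c\<in>?C. \<exists>J\<subseteq>I - {t}. card J = (d * K + 1) ^ w \<and> full tr P J (?F \<inter> {b. b ! fst c = snd c})"
      by (rule full_cover[OF _ full _ card]) (use T Suc.prems in fastforce)+
    then obtain u e J where u: "u < d" "u \<notin> V" and J: "J \<subseteq> I - {t}" "card J = (d * K + 1) ^ w"
      "full tr P J (?F \<inter> {b. b ! u = e})"
      by auto
    define F1 where "F1 = ?F \<inter> {b. b ! u = e}"
    have "\<exists>t\<in>J. \<exists>F'\<subseteq>F1. \<exists>V'\<subseteq>{..<d}. constant_on_coords V' F' \<and>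
      avoiding (tr t) (P t) K ({..<d} - V') F'"
    proof (rule Suc.IH[OF J(3)[folded F1_def], where V = "insert u V"])
      show "finite J" using J(1) Suc.prems(2) by (meson finite_Diff finite_subset)
      have "{..<d} - insert u V = ({..<d} - V) - {u}" by auto
      then show "card ({..<d} - insert u V) = w" using Suc.prems(5) u by simp
      show "constant_on_coords (insert u V) F1"
        using Suc.prems(6) by (auto simp: constant_on_coords_def F1_def)
      show "\<And>t. t \<in> J \<Longrightarrow> P t \<noteq> {}" using J(1) Suc.prems(7) by auto
    qed (use J u Suc.prems in auto)
    moreover have "J \<subseteq> I" "F1 \<subseteq> F" using J(1) by (auto simp: F1_def)
    ultimately show ?thesis by (meson order_trans subsetD)
  qed
qed

text \<open>Each new tuple avoids \<open>E\<close> and all entries of its predecessors, at most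
  \<open>card E + m * d\<close> values in total, which the budget \<open>K\<close> allows.\<close>

lemma greedy_choice:
  fixes F :: "'a list set"
  assumes "avoiding tr P K W F"
    and "finite E" "card E + m * d \<le> K" "\<And>b. b \<in> F \<Longrightarrow> length b = d" "\<And>i. i < m \<Longrightarrow> s i \<in> P"
  shows "\<exists>b. \<forall>i<m. b i \<in> F \<and> tr (b i) = s i \<and> (\<forall>u\<in>W. b i ! u \<notin> E) \<and>
    (\<forall>j<i. \<forall>u\<in>W. b i ! u \<notin> set (b j))"
  using assms(3,5)
proof (induction m)
  case (Suc m)
  then obtain b where b: "\<forall>i<m. b i \<in> F \<and> tr (b i) = s i \<and> (\<forall>u\<in>W. b i ! u \<notin> E) \<and>
    (\<forall>j<i. \<forall>u\<in>W. b i ! u \<notin> set (b j))"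
    by auto
  let ?E = "E \<union> (\<Union>j<m. set (b j))"
  have "card (\<Union>j<m. set (b j)) \<le> (\<Sum>j<m. card (set (b j)))" by (rule card_UN_le) auto
  also have "\<dots> \<le> (\<Sum>j<m. d)" using b assms(4) by (intro sum_mono) (metis card_length lessThan_iff)
  finally have "card ?E \<le> K" using Suc.prems(1) card_Un_le[of E "\<Union>j<m. set (b j)"] by simp
  moreover have "finite ?E" using assms(2) by auto
  ultimately obtain c where c: "c \<in> F" "tr c = s m" "\<forall>u\<in>W. c ! u \<notin> ?E"
    using assms(1) Suc.prems(2)[of m] unfolding avoiding_def by blast
  show ?case
    by (rule exI[of _ "b(m := c)"]) (use b c in \<open>auto simp: less_Suc_eq\<close>)
qed auto

section \<open>Equality types of generic pairs\<close>

lemma equality_type_mem: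
  assumes "is_struct L M" "underlying A \<subseteq> univ M" "c \<in> tuples (univ M) n"
  shows "{\<psi> \<in> {\<psi>. rels \<psi> = {} \<and> vars \<psi> \<subseteq> Inl ` {..<n} \<union> Inr ` underlying A}. sat M (asg c) \<psi>}
    \<in> eq_types L n A"
  unfolding eq_types_def
  by (intro CollectI, rule max_consistent_theory[OF assms]) auto

text \<open>The constants \<open>e u\<close> may coincide with each other or lie in
  \<open>U\<close>; only the remaining entries must avoid both.\<close>

definition generic :: "nat \<Rightarrow> nat set \<Rightarrow> (nat \<Rightarrow> 'a) \<Rightarrow> 'a set \<Rightarrow> 'a list \<Rightarrow> bool" where
  "generic d V e U b \<longleftrightarrow> length b = d \<and> (\<forall>u\<in>V. b ! u = e u) \<and>
     (\<forall>u\<in>{..<d} - V. b ! u \<notin> U \<union> e ` V)"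

text \<open>Terms are entries of either tuple or parameters. Inside a tuple, equalities agree by
  \<open>ker\<close>; among constants and parameters they are the same for all generic tuples; a
  non-constant entry equals no parameter, no constant and, by \<open>cross\<close>, no non-constant
  entry of the other tuple.\<close>

lemma equality_pattern_generic:
  assumes gen: "generic d V e U b" "generic d V e U b'" "generic d V e U c" "generic d V e U c'"
    and ker: "\<And>u v. u < d \<Longrightarrow> v < d \<Longrightarrow> b ! u = b ! v \<longleftrightarrow> c ! u = c ! v"
      "\<And>u v. u < d \<Longrightarrow> v < d \<Longrightarrow> b' ! u = b' ! v \<longleftrightarrow> c' ! u = c' ! v"
    and cross: "\<And>u v. u \<in> {..<d} - V \<Longrightarrow> v \<in> {..<d} - V \<Longrightarrow> b ! u \<noteq> b' ! v \<and> c ! u \<noteq> c' ! v"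
    and x: "x \<in> Inl ` {..<2 * d} \<union> Inr ` U" and y: "y \<in> Inl ` {..<2 * d} \<union> Inr ` U"
  shows "asg (b @ b') x = asg (b @ b') y \<longleftrightarrow> asg (c @ c') x = asg (c @ c') y"
proof -
  have len: "length b = d" "length c = d" "length b' = d" "length c' = d"
    using gen by (auto simp: generic_def)
  have cr: "b ! u = b' ! v \<longleftrightarrow> c ! u = c' ! v" if "u < d" "v < d" for u v
  proof (cases "u \<in> V"; cases "v \<in> V")
    assume "u \<in> V" "v \<in> V" then show ?thesis using gen by (simp add: generic_def)
  next
    assume *: "u \<in> V" "v \<notin> V"
    then have "b' ! v \<notin> e ` V" "c' ! v \<notin> e ` V" "b ! u \<in> e ` V" "c ! u \<in> e ` V"
      using gen that by (auto simp: generic_def)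
    then show ?thesis by metis
  next
    assume *: "u \<notin> V" "v \<in> V"
    then have "b ! u \<notin> e ` V" "c ! u \<notin> e ` V" "b' ! v \<in> e ` V" "c' ! v \<in> e ` V"
      using gen that by (auto simp: generic_def)
    then show ?thesis by metis
  next
    assume "u \<notin> V" "v \<notin> V" then show ?thesis using cross[of u v] that by auto
  qed
  have par: "b ! u = a \<longleftrightarrow> c ! u = a" "b' ! u = a \<longleftrightarrow> c' ! u = a" if "u < d" "a \<in> U" for u a
  proof -
    have "(b ! u = a \<longleftrightarrow> c ! u = a) \<and> (b' ! u = a \<longleftrightarrow> c' ! u = a)"
    proof (cases "u \<in> V")
      case True then show ?thesis using gen by (simp add: generic_def)
    next
      case False
      then have "b ! u \<notin> U" "c ! u \<notin> U" "b' ! u \<notin> U" "c' ! u \<notin> U"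
        using gen that by (auto simp: generic_def)
      then show ?thesis using that by metis
    qed
    then show "b ! u = a \<longleftrightarrow> c ! u = a" "b' ! u = a \<longleftrightarrow> c' ! u = a" by auto
  qed
  have cases: "(\<exists>u<d. asg (b @ b') z = b ! u \<and> asg (c @ c') z = c ! u) \<or>
      (\<exists>u<d. asg (b @ b') z = b' ! u \<and> asg (c @ c') z = c' ! u) \<or>
      (\<exists>a\<in>U. asg (b @ b') z = a \<and> asg (c @ c') z = a)"
    if z: "z \<in> Inl ` {..<2 * d} \<union> Inr ` U" for z
  proof -
    consider n where "z = Inl n" "n < d" | n where "z = Inl (d + n)" "n < d"
      | a where "a \<in> U" "z = Inr a"
    proof (cases z)
      case (Inl n)
      then have "n < 2 * d" using z by auto
      then show ?thesis using that(1,2) Inl by (metis add_diff_inverse_nat mult_2 nat_add_left_cancel_less)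
    next
      case (Inr a) then show ?thesis using z that(3) by auto
    qed
    then show ?thesis by cases (auto simp: asg_def nth_append len)
  qed
  from cases[OF x] cases[OF y] show ?thesis
    by (elim disjE exE conjE bexE) (use ker cr par in metis)+
qed

section \<open>From shattered boxes to generic families\<close>

lemma Sup_enat_infinite:
  "Sup {enat m | m. Q m} = \<infinity> \<longleftrightarrow> (\<forall>n. \<exists>m\<ge>n. Q m)"
proof
  assume inf: "Sup {enat m | m. Q m} = \<infinity>"
  show "\<forall>n. \<exists>m\<ge>n. Q m"
  proof
    fix n
    have "enat n < Sup {enat m | m. Q m}" using inf by simp
    then obtain m where "Q m" "enat n < enat m" unfolding less_Sup_iff by auto
    then show "\<exists>m\<ge>n. Q m" by (intro exI[of _ m]) auto
  qed
next
  assume *: "\<forall>n. \<exists>m\<ge>n. Q m"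
  show "Sup {enat m | m. Q m} = \<infinity>"
  proof (rule ccontr)
    assume "Sup {enat m | m. Q m} \<noteq> \<infinity>"
    then obtain k where k: "Sup {enat m | m. Q m} = enat k" by auto
    obtain m where m: "m \<ge> Suc k" "Q m" using * by blast
    then have "enat m \<le> enat k" unfolding k[symmetric] by (intro Sup_upper) auto
    then show False using m by simp
  qed
qed

text \<open>The nested suprema merge into one over pairs of structure and height, so the member of
  \<open>H\<close> may vary with the height.\<close>

lemma VC_infinite_iff:
  "VC l \<phi> H = \<infinity> \<longleftrightarrow>
    (\<forall>n. \<exists>m\<ge>n. \<exists>M\<in>H. \<exists>A. is_box (univ M) l (ylen \<phi>) m A \<and> shatters (deffam \<phi> M) A)"
proof -
  let ?Q = "\<lambda>M m. \<exists>A. is_box (univ M) l (ylen \<phi>) m A \<and> shatters (deffam \<phi> M) A"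
  have "VC l \<phi> H = Sup (\<Union>M\<in>H. {enat m | m. ?Q M m})"
    using SUP_UNION[of "\<lambda>x. x" "\<lambda>M. {enat m | m. ?Q M m}" H] by (simp add: VC_def VC_struct_def)
  also have "(\<Union>M\<in>H. {enat m | m. ?Q M m}) = {enat m | m. \<exists>M\<in>H. ?Q M m}" by auto
  finally show ?thesis by (simp only: Sup_enat_infinite)
qed

text \<open>Two reductions of the blocks of one tall shattered box: \<open>full_cover\<close> first
  fixes the equalities inside the tuples, then \<open>generic_block\<close> finds the block
  \<open>B\<close> and the constant coordinates \<open>V\<close>.\<close>

lemma generic_family:
  fixes H :: "('a, 'r) struct set"
  assumes "VC l \<phi> H = \<infinity>" "1 \<le> m"
  obtains M B F V where "M \<in> H" "is_box (univ M) l (ylen \<phi>) m B"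
    "F \<subseteq> tuples (univ M) (xlen \<phi>)" "V \<subseteq> {..<xlen \<phi>}" "constant_on_coords V F"
    "\<And>b c u v. b \<in> F \<Longrightarrow> c \<in> F \<Longrightarrow> u < xlen \<phi> \<Longrightarrow> v < xlen \<phi> \<Longrightarrow> b ! u = b ! v \<longleftrightarrow> c ! u = c ! v"
    "avoiding (trace \<phi> M B) (Pow B) K ({..<xlen \<phi>} - V) F"
proof -
  let ?d = "xlen \<phi>"
  \<comment> \<open>The colours are the possible equality relations between positions, and
    \<open>G c\<close> collects the tuples with relation \<open>c\<close>. \<open>?N\<close> is the
    number of blocks that \<open>generic_block\<close> needs when it starts with no constant
    coordinate.\<close>
  let ?C = "Pow ({..<?d} \<times> {..<?d})" and ?N = "(?d * K + 1) ^ ?d"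
  define k where "k = ?N * card ?C"
  define G where "G c = {b :: 'a list. c = {(u, v). u < ?d \<and> v < ?d \<and> b ! u = b ! v}}" for c
  obtain m' M A where m': "k * m \<le> m'" and M: "M \<in> H"
    and box: "is_box (univ M) l (ylen \<phi>) m' A" and sh: "shatters (deffam \<phi> M) A"
    using assms(1) unfolding VC_infinite_iff by metis
  obtain ks As where ks: "1 \<le> l" "l \<le> ylen \<phi>" "length ks = l" "sum_list ks = ylen \<phi>"
    and sides: "box_sides (univ M) ks m' As" and A: "A = concat ` listset As"
    using box unfolding is_box_iff by blast
  have "ks \<noteq> []" using ks by auto
  obtain Bs where Bs: "\<And>t. t < k \<Longrightarrow> box_sides (univ M) ks m (Bs t)"
    "\<And>t. t < k \<Longrightarrow> concat ` listset (Bs t) \<subseteq> A"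
    "\<And>t t'. t < k \<Longrightarrow> t' < k \<Longrightarrow> t \<noteq> t' \<Longrightarrow>
      concat ` listset (Bs t) \<inter> concat ` listset (Bs t') = {}"
    by (rule disjoint_subboxes[OF sides m' assms(2) \<open>ks \<noteq> []\<close>, folded A]) (rule that)
  define B where "B t = concat ` listset (Bs t)" for t
  define tr where "tr t = trace \<phi> M (B t)" for t
  \<comment> \<open>Shattering yields one tuple that cuts out the union of the chosen subsets;
    disjointness of the blocks recovers each choice from it.\<close>
  have full: "full tr (\<lambda>t. Pow (B t)) {..<k} (tuples (univ M) ?d)"
    unfolding full_def
  proof
    fix f assume f: "f \<in> (\<Pi> t\<in>{..<k}. Pow (B t))"
    have "(\<Union>t<k. f t) \<in> Pow A" using f Bs(2) unfolding B_def by blast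
    then have "(\<Union>t<k. f t) \<in> {F \<inter> A | F. F \<in> deffam \<phi> M}"
      using sh unfolding shatters_def by (simp only:)
    then obtain b where b: "b \<in> tuples (univ M) ?d" "defset \<phi> M b \<inter> A = (\<Union>t<k. f t)"
      unfolding deffam_def by auto
    have "tr t b = f t" if t: "t < k" for t
    proof -
      have "tr t b = (\<Union>s<k. f s) \<inter> B t"
        using Bs(2)[OF t] b(2) unfolding tr_def trace_def B_def by blast
      also have "\<dots> = f t" using f t Bs(3)[of _ t] unfolding B_def by blast
      finally show ?thesis .
    qed
    then show "\<exists>b\<in>tuples (univ M) ?d. \<forall>t\<in>{..<k}. tr t b = f t" using b(1) by auto
  qed
  have "\<exists>c\<in>?C. \<exists>J\<subseteq>{..<k}. card J = ?N \<and> full tr (\<lambda>t. Pow (B t)) J (tuples (univ M) ?d \<inter> G c)"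
  proof (rule full_cover[OF _ full])
    show "tuples (univ M) ?d \<subseteq> (\<Union>c\<in>?C. G c)"
    proof
      fix b :: "'a list"
      have "b \<in> G {(u, v). u < ?d \<and> v < ?d \<and> b ! u = b ! v}" by (simp add: G_def)
      then show "b \<in> (\<Union>c\<in>?C. G c)" by (rule UN_I[rotated]) auto
    qed
    show "?N * card ?C \<le> card {..<k}" unfolding k_def by simp
  qed auto
  then obtain c J where J: "J \<subseteq> {..<k}" "card J = ?N"
    "full tr (\<lambda>t. Pow (B t)) J (tuples (univ M) ?d \<inter> G c)"
    by blast
  have "finite J" using J(1) by (rule finite_subset) simp
  then have "\<exists>t\<in>J. \<exists>F'\<subseteq>tuples (univ M) ?d \<inter> G c. \<exists>V'\<subseteq>{..<?d}. constant_on_coords V' F' \<and>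
    avoiding (tr t) (Pow (B t)) K ({..<?d} - V') F'"
    by (intro generic_block[OF J(3), where V = "{}" and w = ?d])
      (use J(2) in \<open>auto simp: constant_on_coords_def\<close>)
  then obtain t F V where t: "t \<in> J" and F: "F \<subseteq> tuples (univ M) ?d \<inter> G c"
    and V: "V \<subseteq> {..<?d}" "constant_on_coords V F"
    and gen: "avoiding (tr t) (Pow (B t)) K ({..<?d} - V) F"
    by blast
  show thesis
  proof (rule that[OF M _ _ V])
    show "is_box (univ M) l (ylen \<phi>) m (B t)"
      using ks Bs(1) t J(1) unfolding is_box_iff B_def by blast
    show "b ! u = b ! v \<longleftrightarrow> c' ! u = c' ! v"
      if "b \<in> F" "c' \<in> F" "u < ?d" "v < ?d" for b c' u v
    proof -
      have "(u, v) \<in> c \<longleftrightarrow> b ! u = b ! v" if "b \<in> F" for b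
      proof -
        have "b \<in> G c" using that F by auto
        then show ?thesis using \<open>u < ?d\<close> \<open>v < ?d\<close> by (simp add: G_def)
      qed
      then show ?thesis using that(1,2) by metis
    qed
  qed (use F gen in \<open>auto simp: tr_def[abs_def]\<close>)
qed

text \<open>All sequences are realized in one structure by tuples from one family \<open>F\<close>.
  Greedy choice makes any two of them a generic pair, so the equality type of a single reference
  pair serves as \<open>\<rho>\<close> for all.\<close>

lemma generic_sequence:
  assumes "VC l \<phi> H = \<infinity>" "2 \<le> m" "\<forall>M\<in>H. is_struct L M"
  obtains A \<rho> where "is_box UNIV l (ylen \<phi>) m A" "\<rho> \<in> eq_types L (2 * xlen \<phi>) A"
    "\<forall>s \<in> {..<m} \<rightarrow>\<^sub>E Pow A. realizable H \<phi> m A \<rho> s"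
proof -
  let ?d = "xlen \<phi>"
  \<comment> \<open>The summands bound the entries of the box, the constant values, and the entries
    of \<open>m\<close> tuples.\<close>
  let ?K = "m ^ l * ylen \<phi> + ?d + m * ?d"
  obtain M A F V where M: "M \<in> H" and box: "is_box (univ M) l (ylen \<phi>) m A"
    and F: "F \<subseteq> tuples (univ M) ?d" and V: "V \<subseteq> {..<?d}" "constant_on_coords V F"
    and ker: "\<And>b c u v. b \<in> F \<Longrightarrow> c \<in> F \<Longrightarrow> u < ?d \<Longrightarrow> v < ?d \<Longrightarrow> b ! u = b ! v \<longleftrightarrow> c ! u = c ! v"
    and avoid: "avoiding (trace \<phi> M A) (Pow A) ?K ({..<?d} - V) F"
  proof -
    have "1 \<le> m" using assms(2) by simp
    from generic_family[OF assms(1) this, of ?K] show thesis using that by blast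
  qed
  obtain ks As where ks: "length ks = l" "sum_list ks = ylen \<phi>"
    and sides: "box_sides (univ M) ks m As" and A: "A = concat ` listset As"
    using box unfolding is_box_iff by blast
  have fin: "finite A" "card A = m ^ l" using card_box[OF sides] ks A by auto
  have sub: "A \<subseteq> tuples (univ M) (ylen \<phi>)" using box_subset_tuples[OF sides] ks A by auto
  have lenF: "length b = ?d" if "b \<in> F" for b using F that by (auto simp: tuples_def)
  have gen: "\<exists>b\<in>F. trace \<phi> M A b = T" if "T \<subseteq> A" for T
    using avoid that unfolding avoiding_def by (metis PowI card.empty finite.emptyI le0)
  obtain b0 where b0: "b0 \<in> F" using gen[of "{}"] by auto
  \<comment> \<open>The constant values can be read off from any member of \<open>F\<close>.\<close>
  define e where "e = nth b0"
  let ?U = "underlying A"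
  let ?E = "?U \<union> e ` V"
  have finV: "finite V" using V(1) by (rule finite_subset) simp
  have "card ?U \<le> (\<Sum>a\<in>A. card (set a))" unfolding underlying_def by (rule card_UN_le[OF fin(1)])
  also have "\<dots> \<le> (\<Sum>a\<in>A. ylen \<phi>)"
  proof (rule sum_mono)
    fix a assume "a \<in> A"
    then have "length a = ylen \<phi>" using sub by (auto simp: tuples_def)
    then show "card (set a) \<le> ylen \<phi>" using card_length[of a] by simp
  qed
  finally have "card ?U \<le> m ^ l * ylen \<phi>" using fin by simp
  moreover have "card (e ` V) \<le> ?d"
    using card_image_le[OF finV, of e] card_mono[OF _ V(1)] by simp
  ultimately have cardE: "card ?E + m * ?d \<le> ?K" using card_Un_le[of ?U "e ` V"] by simp
  have finE: "finite ?E" using fin(1) finV by (auto simp: underlying_def)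
  \<comment> \<open>If every coordinate were constant, \<open>F\<close> would hold at most one
    tuple, which cannot have both traces \<open>{}\<close> and \<open>A\<close>. A non-constant
    coordinate is what later makes the chosen tuples distinct.\<close>
  have W: "{..<?d} - V \<noteq> {}"
  proof
    assume "{..<?d} - V = {}"
    then have same: "b = c" if "b \<in> F" "c \<in> F" for b c
      using that V(2) lenF by (intro nth_equalityI) (auto simp: constant_on_coords_def)
    have "A \<noteq> {}" using fin assms(2) by auto
    moreover obtain b c where "b \<in> F" "c \<in> F" "trace \<phi> M A b = {}" "trace \<phi> M A c = A"
      using gen[of "{}"] gen[of A] by auto
    ultimately show False using same by metis
  qed
  define ok where "ok s b \<longleftrightarrow> (\<forall>i<m. b i \<in> F \<and> trace \<phi> M A (b i) = s i \<and>
      (\<forall>u\<in>{..<?d} - V. b i ! u \<notin> ?E) \<and> (\<forall>j<i. \<forall>u\<in>{..<?d} - V. b i ! u \<notin> set (b j)))" for s b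
  have ex_ok: "\<exists>b. ok s b" if "s \<in> {..<m} \<rightarrow>\<^sub>E Pow A" for s
    unfolding ok_def
    by (rule greedy_choice[OF avoid finE cardE lenF]) (use that in auto)
  have okD: "b i \<in> F" "trace \<phi> M A (b i) = s i"
    "\<And>u. u \<in> {..<?d} - V \<Longrightarrow> b i ! u \<notin> ?E"
    "\<And>j u. j < i \<Longrightarrow> u \<in> {..<?d} - V \<Longrightarrow> b i ! u \<notin> set (b j)"
    if "ok s b" "i < m" for s b i
    using that unfolding ok_def by blast+
  have generic: "generic ?d V e ?U (b i)" if "ok s b" "i < m" for s b i
    unfolding generic_def
  proof (intro conjI ballI)
    show "length (b i) = ?d" by (rule lenF[OF okD(1)[OF that]])
    show "b i ! u = e u" if "u \<in> V" for u
      using V(2) okD(1)[OF \<open>ok s b\<close> \<open>i < m\<close>] b0 that unfolding constant_on_coords_def e_def by blast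
    show "b i ! u \<notin> ?E" if "u \<in> {..<?d} - V" for u
      by (rule okD(3)[OF \<open>ok s b\<close> \<open>i < m\<close> that])
  qed
  \<comment> \<open>The later tuple avoids every entry of the earlier one, so \<open>u\<close> may
    be any position; \<open>cross\<close> then makes the statement symmetric in \<open>i\<close> and
    \<open>j\<close>.\<close>
  have cross_less: "b i ! u \<noteq> b j ! v"
    if b: "ok s b" and ij: "i < j" "j < m" and uv: "u < ?d" "v \<in> {..<?d} - V" for s b i j u v
  proof -
    have "i < m" using ij by simp
    have "b i ! u \<in> set (b i)" using uv lenF[OF okD(1)[OF b \<open>i < m\<close>]] by simp
    then show ?thesis using okD(4)[OF b ij(2) ij(1) uv(2)] by metis
  qed
  have cross: "b i ! u \<noteq> b j ! v"
    if b: "ok s b" and ij: "i < m" "j < m" "i \<noteq> j" and uv: "u \<in> {..<?d} - V" "v \<in> {..<?d} - V"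
    for s b i j u v
  proof (cases "i < j")
    case True
    then show ?thesis using cross_less[OF b True ij(2) _ uv(2)] uv by auto
  next
    case False
    then have "j < i" using ij by simp
    then show ?thesis using cross_less[OF b _ ij(1) _ uv(1), of j v] uv by auto
  qed
  let ?\<Delta> = "{\<psi>. rels \<psi> = {} \<and> vars \<psi> \<subseteq> Inl ` {..<2 * ?d} \<union> Inr ` ?U}"
  \<comment> \<open>The reference sequence may be any one; \<open>restrict\<close> makes the
    constant sequence extensional, as \<open>ex_ok\<close> demands. With \<open>2 \<le> m\<close> it
    provides the pair \<open>c 0\<close>, \<open>c 1\<close>.\<close>
  obtain c where c: "ok (restrict (\<lambda>_. {}) {..<m}) c"
    using ex_ok[of "restrict (\<lambda>_. {}) {..<m}"] by auto
  have m: "0 < m" "1 < m" using assms(2) by auto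
  define \<rho> where "\<rho> = {\<psi> \<in> ?\<Delta>. sat M (asg (c 0 @ c 1)) \<psi>}"
  have "c 0 \<in> tuples (univ M) ?d" "c 1 \<in> tuples (univ M) ?d"
    using okD(1)[OF c m(1)] okD(1)[OF c m(2)] F by auto
  then have "c 0 @ c 1 \<in> tuples (univ M) (2 * ?d)" by (auto simp: tuples_def)
  moreover have "is_struct L M" using assms(3) M by auto
  ultimately have "\<rho> \<in> eq_types L (2 * ?d) A"
    unfolding \<rho>_def by (intro equality_type_mem underlying_subset[OF sub])
  moreover have "realizable H \<phi> m A \<rho> s" if s: "s \<in> {..<m} \<rightarrow>\<^sub>E Pow A" for s
  proof -
    obtain b where b: "ok s b" using ex_ok[OF s] by auto
    have inj: "inj_on b {..<m}"
    proof (rule inj_onI, rule ccontr)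
      fix i j assume "i \<in> {..<m}" "j \<in> {..<m}" "b i = b j" "i \<noteq> j"
      moreover obtain u where "u \<in> {..<?d} - V" using W by auto
      ultimately show False using cross[OF b, of i j u u] by simp
    qed
    have "sat M (asg (b i @ b j)) \<psi>" if ij: "i < m" "j < m" "i \<noteq> j" and \<psi>: "\<psi> \<in> \<rho>" for i j \<psi>
    proof -
      have "sat M (asg (c 0 @ c 1)) \<psi> \<longleftrightarrow> sat M (asg (b i @ b j)) \<psi>"
      proof (rule sat_equality_cong)
        fix x y assume "x \<in> vars \<psi>" "y \<in> vars \<psi>"
        then have xy: "x \<in> Inl ` {..<2 * ?d} \<union> Inr ` ?U" "y \<in> Inl ` {..<2 * ?d} \<union> Inr ` ?U"
          using \<psi> by (auto simp: \<rho>_def)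
        note inF = okD(1)[OF c m(1)] okD(1)[OF c m(2)] okD(1)[OF b ij(1)] okD(1)[OF b ij(2)]
        show "asg (c 0 @ c 1) x = asg (c 0 @ c 1) y \<longleftrightarrow> asg (b i @ b j) x = asg (b i @ b j) y"
          by (rule equality_pattern_generic[OF generic[OF c m(1)] generic[OF c m(2)]
              generic[OF b ij(1)] generic[OF b ij(2)] _ _ _ xy])
            (use ker[OF inF(1) inF(3)] ker[OF inF(2) inF(4)] cross[OF c m] cross[OF b ij] in simp_all)
      qed (use \<psi> in \<open>auto simp: \<rho>_def\<close>)
      then show ?thesis using \<psi> by (simp add: \<rho>_def)
    qed
    moreover have "b i \<in> tuples (univ M) ?d \<and> trace \<phi> M A (b i) = s i" if "i < m" for i
      using okD(1,2)[OF b that] F by auto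
    ultimately show ?thesis
      unfolding realizable_def satisfies_def using M sub inj by blast
  qed
  moreover have "box_sides UNIV ks m As" using sides by (auto simp: box_sides_def tuples_def)
  then have "is_box UNIV l (ylen \<phi>) m A" using box ks A unfolding is_box_iff by blast
  ultimately show thesis using that by blast
qed

section \<open>From the maximal number of types back to shattered boxes\<close>

lemma box_card:
  assumes "is_box X l t m A"
  shows "finite A" "card A = m ^ l"
  using assms card_box unfolding is_box_iff by blast+

text \<open>As \<open>2 ^ (n ^ l) \<le> m\<close>, one sequence can list all subsets of a subbox of
  height \<open>n\<close>. Realizing that sequence takes a single structure, so this structure
  shatters the subbox.\<close>

lemma shatters_of_realizable:
  fixes A :: "'a list set"
  assumes "\<forall>s \<in> {..<m} \<rightarrow>\<^sub>E Pow A. realizable H \<phi> m A \<rho> s"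
    and "is_box UNIV l (ylen \<phi>) m A" "1 \<le> n" "n \<le> m" "2 ^ (n ^ l) \<le> m"
  shows "\<exists>M\<in>H. \<exists>B. is_box (univ M) l (ylen \<phi>) n B \<and> shatters (deffam \<phi> M) B"
proof -
  obtain ks As where ks: "1 \<le> l" "l \<le> ylen \<phi>" "length ks = l" "sum_list ks = ylen \<phi>"
    and sides: "box_sides UNIV ks m As" and A: "A = concat ` listset As"
    using assms(2) unfolding is_box_iff by blast
  have "ks \<noteq> []" "1 * n \<le> m" using ks assms(4) by auto
  obtain Bs where "\<And>t::nat. t < 1 \<Longrightarrow> box_sides UNIV ks n (Bs t)"
    "\<And>t::nat. t < 1 \<Longrightarrow> concat ` listset (Bs t) \<subseteq> A"
    by (rule disjoint_subboxes[OF sides \<open>1 * n \<le> m\<close> assms(3) \<open>ks \<noteq> []\<close>, folded A]) (rule that)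
  then have Bs: "box_sides UNIV ks n (Bs 0)" "concat ` listset (Bs 0) \<subseteq> A" by simp_all
  let ?B = "concat ` listset (Bs 0)"
  have "card (Pow ?B) = 2 ^ (n ^ l)" "finite (Pow ?B)"
    using card_box[OF Bs(1)] ks by (auto simp: card_Pow)
  then obtain h :: "nat \<Rightarrow> 'a list set" where h: "h ` {0..<2 ^ (n ^ l)} = Pow ?B"
    using ex_bij_betw_nat_finite[of "Pow ?B"] by (metis bij_betw_def)
  \<comment> \<open>Positions beyond the list of subsets are filled with \<open>{}\<close>.\<close>
  define s where "s = restrict (\<lambda>i. if i < 2 ^ (n ^ l) then h i else {}) {..<m}"
  have "h i \<subseteq> A" if "i < 2 ^ (n ^ l)" for i
  proof -
    have "h i \<in> Pow ?B" using that unfolding h[symmetric] by simp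
    then show ?thesis using Bs(2) by blast
  qed
  then have "s \<in> {..<m} \<rightarrow>\<^sub>E Pow A" by (auto simp: s_def)
  with assms(1) have "realizable H \<phi> m A \<rho> s" by (rule bspec)
  then obtain M b where M: "M \<in> H" "A \<subseteq> tuples (univ M) (ylen \<phi>)"
    and b: "\<And>i. i < m \<Longrightarrow> b i \<in> tuples (univ M) (xlen \<phi>) \<and> trace \<phi> M A (b i) = s i"
    unfolding realizable_def by blast
  have "box_sides (univ M) ks n (Bs 0)"
    by (rule box_sides_restrict[OF Bs(1) subset_trans[OF Bs(2) M(2)]])
  then have "is_box (univ M) l (ylen \<phi>) n ?B" using ks unfolding is_box_iff by blast
  moreover have "T \<in> {F \<inter> ?B | F. F \<in> deffam \<phi> M}" if "T \<subseteq> ?B" for T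
  proof -
    have "T \<in> h ` {0..<2 ^ (n ^ l)}" unfolding h using that by simp
    then obtain i where i: "i < 2 ^ (n ^ l)" "h i = T" by auto
    then have "b i \<in> tuples (univ M) (xlen \<phi>)" "defset \<phi> M (b i) \<inter> A = T"
      using b[of i] assms(5) by (auto simp: s_def trace_def)
    then show ?thesis using that Bs(2) unfolding deffam_def by blast
  qed
  then have "shatters (deffam \<phi> M) ?B" unfolding shatters_def by blast
  ultimately show ?thesis using M by blast
qed

theorem theorem9:
  fixes L :: "'r language" and H :: "('a, 'r) struct set" and l :: nat
  assumes "infinite (UNIV :: 'a set)"
    and "finite (symbols L)"
    and "hereditary_property L H"
    and "1 \<le> l"
  shows "VC_infinite L l H \<longleftrightarrow> VC_star_infinite L l H"
proof -
  have struct: "\<forall>M\<in>H. is_struct L M" using assms(3) by (simp add: hereditary_property_def)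
  have "VC l \<phi> H = \<infinity> \<longleftrightarrow> VC_star L l \<phi> H = \<infinity>" for \<phi>
  proof
    assume inf: "VC l \<phi> H = \<infinity>"
    show "VC_star L l \<phi> H = \<infinity>"
      unfolding VC_star_def Sup_enat_infinite
    proof
      fix n :: nat
      \<comment> \<open>The offset guarantees the two tuples from which \<open>\<rho>\<close> is
        read.\<close>
      define m where "m = n + 2"
      have m: "2 \<le> m" "0 < m" "n \<le> m" by (simp_all add: m_def)
      obtain A \<rho> where A: "is_box UNIV l (ylen \<phi>) m A" "\<rho> \<in> eq_types L (2 * xlen \<phi>) A"
        "\<forall>s \<in> {..<m} \<rightarrow>\<^sub>E Pow A. realizable H \<phi> m A \<rho> s"
        by (rule generic_sequence[OF inf m(1) struct]) (rule that)
      have "card (types_seq L H \<phi> m A \<rho>) = 2 ^ (m ^ (l + 1))"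
        using card_types_seq_iff[OF struct m(2) box_card[OF A(1)]] A(3) by blast
      then show "\<exists>m\<ge>n. \<exists>A \<rho>. is_box UNIV l (ylen \<phi>) m A \<and> \<rho> \<in> eq_types L (2 * xlen \<phi>) A \<and>
          card (types_seq L H \<phi> m A \<rho>) = 2 ^ (m ^ (l + 1))"
        using A(1,2) m(3) by blast
    qed
  next
    assume inf: "VC_star L l \<phi> H = \<infinity>"
    show "VC l \<phi> H = \<infinity>"
      unfolding VC_infinite_iff
    proof
      fix n
      \<comment> \<open>The successor makes the height of the subbox positive. The bound on
        \<open>m\<close> below leaves room both for the subbox and for a list of all its
        subsets.\<close>
      let ?n = "Suc n"
      obtain m A \<rho> where m: "m \<ge> ?n + 2 ^ (?n ^ l)" and A: "is_box UNIV l (ylen \<phi>) m A"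
        and card: "card (types_seq L H \<phi> m A \<rho>) = 2 ^ (m ^ (l + 1))"
        using inf unfolding VC_star_def Sup_enat_infinite by blast
      have "0 < m" "?n \<le> m" "2 ^ (?n ^ l) \<le> m" using m by linarith+
      then have "\<forall>s \<in> {..<m} \<rightarrow>\<^sub>E Pow A. realizable H \<phi> m A \<rho> s"
        using card_types_seq_iff[OF struct _ box_card[OF A]] card by blast
      from shatters_of_realizable[OF this A _ \<open>?n \<le> m\<close> \<open>2 ^ (?n ^ l) \<le> m\<close>]
      show "\<exists>m\<ge>n. \<exists>M\<in>H. \<exists>A. is_box (univ M) l (ylen \<phi>) m A \<and> shatters (deffam \<phi> M) A"
        by (intro exI[of _ ?n]) auto
    qed
  qed
  then show ?thesis by (simp add: VC_infinite_def VC_star_infinite_def)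
qed

end
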